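(* Let $\mathbf{s}=(s_1,\dots,s_n)$ be a sequence of positive integers. The map $\operatorname{REM}_{\mathbf{s}}:\operatorname{Par}_{\mathbf{s}}\cap\mathbb{Z}^n\to\Psi_n$ is invertible, and its inverse is \[\operatorname{REM}_{\mathbf{s}}^{-1}:\Psi_n\to\operatorname{Par}_{\mathbf{s}}\cap\mathbb{Z}^n,\quad \mathbf{r}=(r_1,\dots,r_n)\mapsto\big(\operatorname{des}_{\mathbf{s}}^{<1}(\mathbf{r})s_1+r_1,\ \dots,\ \operatorname{des}_{\mathbf{s}}^{<n}(\mathbf{r})s_n+r_n\big).\]
   Context: $\langle N\rangle=\{0,1,\dots,N\}$ and $\Psi_n=\langle s_1-1\rangle\times\cdots\times\langle s_n-1\rangle$. For linearly independent vectors $\mathbf{w}_1,\dots,\mathbf{w}_n$, $\operatorname{Par}(\mathbf{w}_1,\dots,\mathbf{w}_n)=\{\sum_i c_i\mathbf{w}_i: 0\le c_i<1\}$. $\operatorname{Par}_{\mathbf{s}}=\operatorname{Par}(\mathbf{w}_1,\dots,\mathbf{w}_n)$ where $\mathbf{w}_j=(0,\dots,0,s_j,s_{j+1},\dots,s_n)$ (with $j-1$ leading zeros). For $\mathbf{x}\in\operatorname{Par}_{\mathbf{s}}\cap\mathbb{Z}^n$, write $x_i=k_is_i+r_i$ with $k_i=\lfloor x_i/s_i\rfloor$ and $r_i\in\langle s_i-1\rangle$; then $\operatorname{REM}_{\mathbf{s}}(\mathbf{x})=(r_1,\dots,r_n)$. For $\mathbf{r}\in\mathbb{N}^n$, $j$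 is an $\mathbf{s}$-descent of $\mathbf{r}$ if $r_j/s_j>r_{j+1}/s_{j+1}$ ($1\le j\le n-1$), and $\operatorname{des}_{\mathbf{s}}^{<i}(\mathbf{r})$ is the number of $\mathbf{s}$-descents $j$ of $\mathbf{r}$ with $j<i$. *)

theory Defs
  imports Complex_Main "HOL-Library.FuncSet"
begin

text \<open>
  A vector of \<open>\<real>\<^sup>n\<close> is a function \<open>nat \<Rightarrow> real\<close> in \<open>extensional {1..n}\<close>: the coordinates are
  indexed by \<open>1, \<dots>, n\<close>, and all values outside \<open>{1..n}\<close> are \<open>undefined\<close>, so equality of
  functions is equality of vectors.  The lattice \<open>\<int>\<^sup>n\<close> and the box \<open>\<Psi>\<^sub>n\<close> are taken inside
  \<open>\<real>\<^sup>n\<close>.  A sequence \<open>s\<close> is a function \<open>nat \<Rightarrow> nat\<close> of which only \<open>s 1, \<dots>, s n\<close> are used.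
\<close>

definition int_lattice :: "nat \<Rightarrow> (nat \<Rightarrow> real) set" where
  "int_lattice n = ({1..n} \<rightarrow>\<^sub>E \<int>)"

definition Psi :: "nat \<Rightarrow> (nat \<Rightarrow> nat) \<Rightarrow> (nat \<Rightarrow> real) set" where
  "Psi n s = (\<Pi>\<^sub>E i\<in>{1..n}. real ` {0..s i - 1})"

text \<open>The half-open parallelepiped spanned by \<open>w 1, \<dots>, w n\<close>, where \<open>w j i\<close> is the
  \<open>i\<close>-th coordinate of the \<open>j\<close>-th vector.\<close>

definition Par :: "nat \<Rightarrow> (nat \<Rightarrow> nat \<Rightarrow> real) \<Rightarrow> (nat \<Rightarrow> real) set" where
  "Par n w = {(\<lambda>i\<in>{1..n}. \<Sum>j=1..n. c j * w j i) | c. \<forall>j\<in>{1..n}. 0 \<le> c j \<and> c j < 1}"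

definition lecture_hall_gen :: "(nat \<Rightarrow> nat) \<Rightarrow> nat \<Rightarrow> nat \<Rightarrow> real" where
  "lecture_hall_gen s j i = (if i < j then 0 else real (s i))"

definition Par_s :: "nat \<Rightarrow> (nat \<Rightarrow> nat) \<Rightarrow> (nat \<Rightarrow> real) set" where
  "Par_s n s = Par n (lecture_hall_gen s)"

text \<open>The remainder \<open>r\<^sub>i\<close> in \<open>x\<^sub>i = k\<^sub>i s\<^sub>i + r\<^sub>i\<close> with \<open>k\<^sub>i = \<lfloor>x\<^sub>i / s\<^sub>i\<rfloor>\<close>.\<close>

definition REM :: "nat \<Rightarrow> (nat \<Rightarrow> nat) \<Rightarrow> (nat \<Rightarrow> real) \<Rightarrow> (nat \<Rightarrow> real)" where
  "REM n s x = (\<lambda>i\<in>{1..n}. x i - of_int \<lfloor>x i / real (s i)\<rfloor> * real (s i))"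

definition is_descent :: "nat \<Rightarrow> (nat \<Rightarrow> nat) \<Rightarrow> (nat \<Rightarrow> real) \<Rightarrow> nat \<Rightarrow> bool" where
  "is_descent n s r j \<longleftrightarrow> 1 \<le> j \<and> j < n \<and> r j / real (s j) > r (j + 1) / real (s (j + 1))"

definition des_lt :: "nat \<Rightarrow> (nat \<Rightarrow> nat) \<Rightarrow> nat \<Rightarrow> (nat \<Rightarrow> real) \<Rightarrow> nat" where
  "des_lt n s i r = card {j. is_descent n s r j \<and> j < i}"

end

theory Submission
  imports Defs
begin

text \<open>
  Put \<open>y\<^sub>i = x\<^sub>i / s\<^sub>i\<close> and \<open>y\<^sub>0 = 0\<close>. A point lies in the parallelepiped iff all increments
  \<open>y\<^sub>i - y\<^sub>i\<^sub>-\<^sub>1\<close> are in \<open>[0, 1)\<close>. Hence \<open>\<lfloor>y\<^sub>1\<rfloor> = 0\<close>, and from \<open>i\<close> to \<open>i + 1\<close> the floor of \<open>y\<close>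
  grows by 1 exactly when the fractional part \<open>r\<^sub>i / s\<^sub>i\<close> drops, that is at the descents of \<open>r\<close>,
  and stays constant otherwise. So \<open>\<lfloor>y\<^sub>i\<rfloor>\<close> counts the descents before \<open>i\<close>.
\<close>

lemma des_lt_Suc_0: "des_lt n s (Suc 0) r = 0"
  by (auto simp: des_lt_def is_descent_def)

lemma des_lt_Suc:
  "des_lt n s (Suc i) r = des_lt n s i r + of_bool (is_descent n s r i)"
proof -
  have "{j. is_descent n s r j \<and> j < Suc i} =
      {j. is_descent n s r j \<and> j < i} \<union> (if is_descent n s r i then {i} else {})"
    by (auto simp: less_Suc_eq)
  then show ?thesis
    by (simp add: des_lt_def)
qed

text \<open>Generators with index above \<open>i\<close> vanish at coordinate \<open>i\<close>; all
  others share the entry \<open>s i\<close>, which factors out.\<close>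

lemma sum_lecture_hall_gen:
  assumes "i \<le> n"
  shows "(\<Sum>j=1..n. c j * lecture_hall_gen s j i) = (\<Sum>j=1..i. c j) * real (s i)"
proof -
  have "(\<Sum>j=1..n. c j * lecture_hall_gen s j i) = (\<Sum>j=1..i. c j * real (s i))"
    by (rule sum.mono_neutral_cong_right) (use assms in \<open>auto simp: lecture_hall_gen_def\<close>)
  then show ?thesis
    by (simp add: sum_distrib_right)
qed

text \<open>Dividing coordinate \<open>i\<close> by \<open>s i\<close> leaves the partial sum c_1 +
  ... + c_i, so the coefficients are exactly the increments of \<open>y x\<close>.\<close>

lemma Par_s_iff:
  assumes pos: "\<forall>i\<in>{1..n}. 0 < s i"
  defines "y \<equiv> (\<lambda>x i. if i = 0 then 0 else x i / real (s i))"
  shows "x \<in> Par_s n s \<longleftrightarrow>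
    x \<in> extensional {1..n} \<and> (\<forall>i<n. y x i \<le> y x (Suc i) \<and> y x (Suc i) < y x i + 1)"
    (is "_ \<longleftrightarrow> ?R")
proof
  assume "x \<in> Par_s n s"
  then obtain c where c: "\<And>j. j \<in> {1..n} \<Longrightarrow> 0 \<le> c j \<and> c j < 1"
    and x: "x = (\<lambda>i\<in>{1..n}. \<Sum>j=1..n. c j * lecture_hall_gen s j i)"
    unfolding Par_s_def Par_def by blast
  have y: "y x i = (\<Sum>j=1..i. c j)" if "i \<le> n" for i
    using that pos by (cases "i = 0") (simp_all add: y_def x sum_lecture_hall_gen del: One_nat_def)
  have "y x i \<le> y x (Suc i) \<and> y x (Suc i) < y x i + 1" if "i < n" for i
    using c[of "Suc i"] that by (simp add: y)
  then show ?R
    by (simp add: x)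
next
  assume R: ?R
  \<comment> \<open>The value \<open>y x 0 = 0\<close> makes \<open>c 1 = y x 1\<close>, so the sums
    telescope to \<open>y x i\<close> with no constant left over.\<close>
  define c where "c = (\<lambda>j. y x j - y x (j - 1))"
  have c: "0 \<le> c j \<and> c j < 1" if "j \<in> {1..n}" for j
    using R that by (cases j) (auto simp: c_def less_eq_Suc_le algebra_simps)
  have sum_c: "(\<Sum>j=1..i. c j) = y x i" for i
    by (induction i) (simp_all add: c_def, simp add: y_def)
  have "x = (\<lambda>i\<in>{1..n}. \<Sum>j=1..n. c j * lecture_hall_gen s j i)"
  proof (rule extensionalityI)
    show "x i = (\<lambda>i\<in>{1..n}. \<Sum>j=1..n. c j * lecture_hall_gen s j i) i" if "i \<in> {1..n}" for i
      using that pos sum_c[of i] by (simp add: sum_lecture_hall_gen y_def del: One_nat_def)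
  qed (use R in auto)
  then show "x \<in> Par_s n s"
    unfolding Par_s_def Par_def using c by blast
qed

text \<open>Since \<open>b - a\<close> is in [0, 1), the floors differ by 0 or 1. Subtracting this
  difference from \<open>b - a\<close> gives \<open>frac b - frac a\<close>, which is nonnegative
  for 0 and negative for 1.\<close>

lemma floor_step:
  fixes a b :: real
  assumes "a \<le> b" "b < a + 1"
  shows "\<lfloor>b\<rfloor> = \<lfloor>a\<rfloor> + of_bool (frac b < frac a)"
proof (cases "frac b < frac a")
  case True
  then show ?thesis
    using assms unfolding frac_def by (simp, linarith)
next
  case False
  then show ?thesis
    using assms unfolding frac_def by (simp, linarith)
qed

lemma REM_divide:
  assumes "i \<in> {1..n}" "0 < s i"
  shows "REM n s x i / real (s i) = frac (x i / real (s i))"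
  using assms by (simp add: REM_def frac_def field_simps)

text \<open>At an integer coordinate the floor is integer division; the bounds on \<open>mod\<close>
  then place the remainder in \<open>Psi\<close>.\<close>

lemma REM_eq_mod:
  assumes "i \<in> {1..n}" "x i = of_int m"
  shows "REM n s x i = of_int (m mod int (s i))"
proof -
  have "\<lfloor>x i / real (s i)\<rfloor> = m div int (s i)"
    using floor_divide_of_int_eq[of m "int (s i)"] assms by simp
  then have "REM n s x i = of_int (m - (m div int (s i)) * int (s i))"
    using assms by (simp add: REM_def)
  then show ?thesis
    by (simp add: minus_div_mult_eq_mod)
qed

lemma REM_mem_Psi:
  assumes pos: "\<forall>i\<in>{1..n}. 0 < s i" and x: "x \<in> int_lattice n"
  shows "REM n s x \<in> Psi n s"
  unfolding Psi_def
proof (rule PiE_I)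
  fix i assume i: "i \<in> {1..n}"
  then obtain m where m: "x i = of_int m"
    using x unfolding int_lattice_def by (meson Ints_cases PiE_mem)
  define k where "k = nat (m mod int (s i))"
  have "REM n s x i = real k"
    using pos i REM_eq_mod[where x = x, OF i m] by (simp add: k_def)
  moreover have "k < s i"
    using pos i by (simp add: k_def nat_less_iff)
  ultimately show "REM n s x i \<in> real ` {0..s i - 1}"
    by auto
qed (auto simp: REM_def)

lemma floor_eq_des_lt:
  assumes pos: "\<forall>i\<in>{1..n}. 0 < s i" and x: "x \<in> Par_s n s"
    and "Suc i \<le> n"
  shows "\<lfloor>x (Suc i) / real (s (Suc i))\<rfloor> = int (des_lt n s (Suc i) (REM n s x))"
  using \<open>Suc i \<le> n\<close>
proof (induction i)
  case 0
  then have "0 \<le> x 1 / real (s 1)" "x 1 / real (s 1) < 1"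
    using Par_s_iff[OF pos, THEN iffD1, OF x] by force+
  then show ?case
    by (simp add: des_lt_Suc_0 floor_eq_iff)
next
  case (Suc i)
  let ?y = "\<lambda>i. x i / real (s i)"
  have step: "?y (Suc i) \<le> ?y (Suc (Suc i))" "?y (Suc (Suc i)) < ?y (Suc i) + 1"
    using Par_s_iff[OF pos, THEN iffD1, OF x] Suc.prems by (auto simp: Suc_le_eq)
  \<comment> \<open>The side condition \<open>Suc i < n\<close> comes from the induction premise;
    the quotients compared in a descent are the fractional parts of \<open>?y\<close>.\<close>
  have "is_descent n s (REM n s x) (Suc i) \<longleftrightarrow> frac (?y (Suc (Suc i))) < frac (?y (Suc i))"
    using Suc.prems pos by (simp add: is_descent_def REM_divide)
  then show ?case
    using floor_step[OF step] Suc by (simp add: des_lt_Suc)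
qed

text \<open>The descent count stands in for the quotient k_i, so a point is rebuilt from its
  remainders alone.\<close>

definition REM_inv :: "nat \<Rightarrow> (nat \<Rightarrow> nat) \<Rightarrow> (nat \<Rightarrow> real) \<Rightarrow> (nat \<Rightarrow> real)" where
  "REM_inv n s r = (\<lambda>i\<in>{1..n}. real (des_lt n s i r) * real (s i) + r i)"

lemma REM_inv_REM:
  assumes pos: "\<forall>i\<in>{1..n}. 0 < s i" and x: "x \<in> Par_s n s"
  shows "REM_inv n s (REM n s x) = x"
proof (rule extensionalityI)
  show "x \<in> extensional {1..n}"
    using x by (auto simp: Par_s_def Par_def)
  fix i assume i: "i \<in> {1..n}"
  then have "real (des_lt n s i (REM n s x)) = of_int \<lfloor>x i / real (s i)\<rfloor>"
    using floor_eq_des_lt[OF pos x, of "i - 1"] by simp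
  then show "REM_inv n s (REM n s x) i = x i"
    using i by (simp add: REM_inv_def REM_def)
qed (simp add: REM_inv_def)

lemma Psi_bounds:
  assumes pos: "\<forall>i\<in>{1..n}. 0 < s i" and "r \<in> Psi n s" and i: "i \<in> {1..n}"
  shows "r i \<in> \<int>" "0 \<le> r i / real (s i)" "r i / real (s i) < 1"
proof -
  from assms obtain k where "r i = real k" "k \<le> s i - 1"
    unfolding Psi_def by (fastforce dest: PiE_mem)
  with bspec[OF pos i] show "r i \<in> \<int>" "0 \<le> r i / real (s i)" "r i / real (s i) < 1"
    by auto
qed

lemma REM_inv_divide:
  assumes "i \<in> {1..n}" "0 < s i"
  shows "REM_inv n s r i / real (s i) = real (des_lt n s i r) + r i / real (s i)"
  using assms by (simp add: REM_inv_def field_simps)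

lemma REM_inv_mem:
  assumes pos: "\<forall>i\<in>{1..n}. 0 < s i" and r: "r \<in> Psi n s"
  shows "REM_inv n s r \<in> Par_s n s \<inter> int_lattice n"
proof
  note b = Psi_bounds[OF pos r]
  show "REM_inv n s r \<in> int_lattice n"
    using b(1) by (auto simp: int_lattice_def REM_inv_def)
  let ?y = "\<lambda>i. if i = 0 then 0 else REM_inv n s r i / real (s i)"
  have "?y i \<le> ?y (Suc i) \<and> ?y (Suc i) < ?y i + 1" if "i < n" for i
  proof (cases "i = 0")
    case True
    then show ?thesis
      using that b[of 1] pos by (simp add: REM_inv_divide des_lt_Suc_0)
  next
    case False
    then have i: "i \<in> {1..n}" "Suc i \<in> {1..n}"
      using that by auto
    \<comment> \<open>With both quotients \<open>r i / s i\<close> and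
      \<open>r (Suc i) / s (Suc i)\<close> in [0, 1), their difference is in [0, 1) without a
      descent. At a descent it is in (-1, 0), and the count adds 1.\<close>
    show ?thesis
      using False that b[OF i(1)] b[OF i(2)] bspec[OF pos i(1)] bspec[OF pos i(2)] i
      by (auto simp: REM_inv_divide des_lt_Suc is_descent_def simp del: divide_less_eq_1_pos)
  qed
  then show "REM_inv n s r \<in> Par_s n s"
    by (subst Par_s_iff[OF pos]) (auto simp: REM_inv_def)
qed

lemma REM_REM_inv:
  assumes pos: "\<forall>i\<in>{1..n}. 0 < s i" and r: "r \<in> Psi n s"
  shows "REM n s (REM_inv n s r) = r"
proof (rule extensionalityI)
  show "r \<in> extensional {1..n}"
    using r by (auto simp: Psi_def PiE_def)
  fix i assume i: "i \<in> {1..n}"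
  \<comment> \<open>The summand \<open>r i / s i\<close> is in [0, 1), so the floor keeps only the
    count.\<close>
  have "\<lfloor>REM_inv n s r i / real (s i)\<rfloor> = int (des_lt n s i r)"
    using Psi_bounds[OF pos r i] pos i by (simp add: REM_inv_divide floor_eq_iff)
  then show "REM n s (REM_inv n s r) i = r i"
    using i by (simp add: REM_def REM_inv_def)
qed (simp add: REM_def)

theorem theorem3p6:
  fixes n :: nat and s :: "nat \<Rightarrow> nat"
  assumes "\<And>i. i \<in> {1..n} \<Longrightarrow> 0 < s i"
  shows "bij_betw (REM n s) (Par_s n s \<inter> int_lattice n) (Psi n s)
    \<and> (\<forall>r\<in>Psi n s. inv_into (Par_s n s \<inter> int_lattice n) (REM n s) r
          = (\<lambda>i\<in>{1..n}. real (des_lt n s i r) * real (s i) + r i))"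
proof -
  have pos: "\<forall>i\<in>{1..n}. 0 < s i"
    using assms by blast
  have bij: "bij_betw (REM n s) (Par_s n s \<inter> int_lattice n) (Psi n s)"
    by (rule bij_betw_byWitness[where f' = "REM_inv n s"])
      (use REM_inv_REM[OF pos] REM_REM_inv[OF pos] REM_mem_Psi[OF pos]
        REM_inv_mem[OF pos] in auto)
  \<comment> \<open>Injectivity makes the preimage unique, so the one chosen by
    \<open>inv_into\<close> must be \<open>REM_inv n s r\<close>.\<close>
  moreover have "inv_into (Par_s n s \<inter> int_lattice n) (REM n s) r = REM_inv n s r"
    if "r \<in> Psi n s" for r
    using REM_inv_mem[OF pos that] REM_REM_inv[OF pos that] bij
    by (intro inv_into_f_eq) (auto simp: bij_betw_def)
  ultimately show ?thesis
    by (simp add: REM_inv_def)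
qed

end
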